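(* Let $G=(V,E)$ be a connected graph, fix $v\in V$, suppose that $v$ has eccentricity $r$ in $G$, and let $1\le c\le |V|$. Then $$M_c^{(v)}(G)\ \le\ (c-1)r .$$
   Context: All graphs are finite and simple. The eccentricity of $v$ is $\max_{u\in V}d(u,v)$, where $d$ is the usual graph distance. The fixed Flood-It game with pivot $v$: let $G=(V,E)$ be a graph with a colouring $\omega:V\to C$, not necessarily proper, where $C$ is a finite colour-set. A monochromatic component is a maximal set of vertices of one colour inducing a connected subgraph. A move consists of a colour $d\in C$ and recolours with colour $d$ every vertex in the monochromatic component (with respect to the current colouring) containing the fixed pivot vertex $v$. For $d\in C$, $m^{(v)}(G,\omega,d)$ is the minimum number of such moves needed, starting from $\omega$, to give all vertices of $G$ colour $d$, and $m^{(v)}(G,\omega)=\min_{d\in C}m^{(v)}(G,\omega,d)$. For a positive integer $c\le|V|$, $M_c^{(v)}(G)=\max_\omega m^{(v)}(G,\omega)$, where the maximum is over all surjective colourings $\omega:V\to\{1,\dots,c\}$ (with colour-set $C=\{1,\dots,c\}$). *)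

theory Defs
  imports
    "Graph_Theory.Graph_Theory"
    "HOL-Library.Extended_Nat"
    "HOL-Library.FuncSet"
begin

text \<open>
  Finite simple graphs are the structures satisfying the locale predicate \<open>graph\<close>: finite,
  loop-free digraphs without parallel arcs whose arc relation is symmetric. Minimum lengths are
  taken in \<^typ>\<open>enat\<close>, so that the minimum over an empty set is \<open>\<infinity>\<close> rather than an arbitrary
  number; over a nonempty set the infimum is attained.
\<close>

definition graph_dist :: "('a, 'b) pre_digraph \<Rightarrow> 'a \<Rightarrow> 'a \<Rightarrow> enat" where
  "graph_dist G u v = (INF p \<in> {p. pre_digraph.awalk G u p v}. enat (length p))"

definition eccentricity :: "('a, 'b) pre_digraph \<Rightarrow> 'a \<Rightarrow> enat" where
  "eccentricity G v = Max ((\<lambda>u. graph_dist G u v) ` verts G)"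

definition mono_connected :: "('a, 'b) pre_digraph \<Rightarrow> ('a \<Rightarrow> 'c) \<Rightarrow> 'a set \<Rightarrow> bool" where
  "mono_connected G \<omega> S \<longleftrightarrow>
     S \<subseteq> verts G \<and> (\<exists>d. \<forall>x\<in>S. \<omega> x = d) \<and> Digraph_Component.connected (G \<restriction> S)"

definition mono_component :: "('a, 'b) pre_digraph \<Rightarrow> ('a \<Rightarrow> 'c) \<Rightarrow> 'a set \<Rightarrow> bool" where
  "mono_component G \<omega> S \<longleftrightarrow>
     mono_connected G \<omega> S \<and> (\<forall>T. mono_connected G \<omega> T \<and> S \<subseteq> T \<longrightarrow> T = S)"

definition flood_move :: "('a, 'b) pre_digraph \<Rightarrow> 'a \<Rightarrow> 'c \<Rightarrow> ('a \<Rightarrow> 'c) \<Rightarrow> ('a \<Rightarrow> 'c)" where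
  "flood_move G v d \<omega> =
     (\<lambda>x. if \<exists>S. mono_component G \<omega> S \<and> v \<in> S \<and> x \<in> S then d else \<omega> x)"

text \<open>\<open>flood_moves G v ds \<omega>\<close> plays the colours in \<open>ds\<close> from left to right.\<close>

definition flood_moves :: "('a, 'b) pre_digraph \<Rightarrow> 'a \<Rightarrow> 'c list \<Rightarrow> ('a \<Rightarrow> 'c) \<Rightarrow> ('a \<Rightarrow> 'c)" where
  "flood_moves G v ds \<omega> = fold (flood_move G v) ds \<omega>"

text \<open>
  \<open>min_moves_to G C v \<omega> d\<close> is $m^{(v)}(G,\omega,d)$, \<open>min_moves G C v \<omega>\<close> is $m^{(v)}(G,\omega)$, both
  for the colour-set \<open>C\<close>, and \<open>max_min_moves G c v\<close> is $M_c^{(v)}(G)$.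
\<close>

definition min_moves_to ::
    "('a, 'b) pre_digraph \<Rightarrow> 'c set \<Rightarrow> 'a \<Rightarrow> ('a \<Rightarrow> 'c) \<Rightarrow> 'c \<Rightarrow> enat" where
  "min_moves_to G C v \<omega> d =
     (INF ds \<in> {ds \<in> lists C. \<forall>x\<in>verts G. flood_moves G v ds \<omega> x = d}. enat (length ds))"

definition min_moves :: "('a, 'b) pre_digraph \<Rightarrow> 'c set \<Rightarrow> 'a \<Rightarrow> ('a \<Rightarrow> 'c) \<Rightarrow> enat" where
  "min_moves G C v \<omega> = Min (min_moves_to G C v \<omega> ` C)"

text \<open>
  Colourings are extensional (\<open>undefined\<close> off the vertex set), so there are finitely many and the
  maximum below is over a finite set, nonempty for \<open>1 \<le> c \<le> card (verts G)\<close>.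
\<close>

definition surj_colourings :: "('a, 'b) pre_digraph \<Rightarrow> nat \<Rightarrow> ('a \<Rightarrow> nat) set" where
  "surj_colourings G c = {\<omega> \<in> verts G \<rightarrow>\<^sub>E {1..c}. \<omega> ` verts G = {1..c}}"

definition max_min_moves :: "('a, 'b) pre_digraph \<Rightarrow> nat \<Rightarrow> 'a \<Rightarrow> enat" where
  "max_min_moves G c v = Max (min_moves G {1..c} v ` surj_colourings G c)"

end

theory Submission
  imports Defs
begin

text \<open>
  Suppose that the component of the pivot contains the ball of radius \<open>k\<close> about it. By maximality it
  then also contains every vertex at distance \<open>k + 1\<close> having the current colour of the pivot, and
  playing the other \<open>c - 1\<close> colours once each, in any order, absorbs all remaining vertices at
  distance \<open>k + 1\<close>. Hence \<open>r\<close> such rounds suffice.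
\<close>

section \<open>The monochromatic region around the pivot\<close>

text \<open>This is the pivot's monochromatic component, encoded without maximality so that a single
  witness set proves membership.\<close>

definition flood_region :: "('a, 'b) pre_digraph \<Rightarrow> 'a \<Rightarrow> ('a \<Rightarrow> 'c) \<Rightarrow> 'a set" where
  "flood_region G v \<omega> = {x. \<exists>S. mono_connected G \<omega> S \<and> v \<in> S \<and> x \<in> S}"

lemma mono_connected_extend:
  assumes "finite (verts G)" and "mono_connected G \<omega> S"
  obtains T where "mono_component G \<omega> T" and "S \<subseteq> T"
proof -
  let ?\<C> = "{T. mono_connected G \<omega> T}"
  have "finite ?\<C>"
    by (rule finite_subset[of _ "Pow (verts G)"]) (auto simp: mono_connected_def assms(1))
  from finite_has_maximal2[OF this, of S] assms(2)
  obtain T where "mono_connected G \<omega> T" "S \<subseteq> T" "\<forall>U\<in>?\<C>. T \<subseteq> U \<longrightarrow> T = U"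
    by auto
  then show thesis
    by (intro that[of T]) (auto simp: mono_component_def)
qed

lemma flood_move_eq:
  assumes "finite (verts G)"
  shows "flood_move G v d \<omega> x = (if x \<in> flood_region G v \<omega> then d else \<omega> x)"
proof -
  have "(\<exists>S. mono_component G \<omega> S \<and> v \<in> S \<and> x \<in> S) \<longleftrightarrow> x \<in> flood_region G v \<omega>"
    unfolding flood_region_def
  proof (intro iffI; clarsimp)
    fix S assume "mono_connected G \<omega> S" "v \<in> S" "x \<in> S"
    then show "\<exists>T. mono_component G \<omega> T \<and> v \<in> T \<and> x \<in> T"
      by (meson mono_connected_extend[OF assms] subsetD)
  qed (auto simp: mono_component_def)
  then show ?thesis
    by (simp add: flood_move_def)
qed

lemma colour_flood_region:
  assumes "x \<in> flood_region G v \<omega>"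
  shows "\<omega> x = \<omega> v"
  using assms by (auto simp: flood_region_def mono_connected_def)

lemma connected_induce_singleton:
  "Digraph_Component.connected (G \<restriction> {v})"
  by (auto simp: connected_conv)

lemma pivot_in_flood_region:
  assumes "v \<in> verts G"
  shows "v \<in> flood_region G v \<omega>"
  using assms connected_induce_singleton[of G v]
  by (auto simp: flood_region_def mono_connected_def intro!: exI[of _ "{v}"])

text \<open>Any two vertices of the larger set are joined through \<open>x\<close>. Connectedness
  refers to the symmetric closure, so one arc out of \<open>u\<close> suffices.\<close>

lemma connected_induce_insert:
  assumes "Digraph_Component.connected (G \<restriction> S)" and "x \<in> S" and "(u, x) \<in> arcs_ends G"
  shows "Digraph_Component.connected (G \<restriction> insert u S)"
proof -
  let ?R = "\<lambda>S. rtrancl_on S ((arcs_ends (G \<restriction> S))\<^sup>s)"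
  let ?T = "insert u S"
  have "arcs_ends (G \<restriction> S) \<subseteq> arcs_ends (G \<restriction> ?T)"
    by (auto simp: arcs_ends_def arc_to_ends_def)
  then have "(arcs_ends (G \<restriction> S))\<^sup>s \<subseteq> (arcs_ends (G \<restriction> ?T))\<^sup>s"
    by (auto simp: symcl_def)
  then have "?R S \<subseteq> ?R ?T"
    by (auto elim!: rtrancl_on_mono[rotated 2])
  then have to_x: "(y, x) \<in> ?R ?T" "(x, y) \<in> ?R ?T" if "y \<in> S" for y
    using assms(1,2) that by (auto simp: connected_conv)
  have "(u, x) \<in> arcs_ends (G \<restriction> ?T)"
    using assms(2,3) by (auto simp: arcs_ends_def arc_to_ends_def)
  then have "(u, x) \<in> (arcs_ends (G \<restriction> ?T))\<^sup>s" "(x, u) \<in> (arcs_ends (G \<restriction> ?T))\<^sup>s"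
    by (auto simp: symcl_def)
  then have "(u, x) \<in> ?R ?T" "(x, u) \<in> ?R ?T"
    using assms(2) by (auto intro: rtrancl_on_into_rtrancl_on)
  with to_x have "(y, x) \<in> ?R ?T" "(x, y) \<in> ?R ?T" if "y \<in> ?T" for y
    using that by auto
  then have "(y, z) \<in> ?R ?T" if "y \<in> ?T" "z \<in> ?T" for y z
    using that rtrancl_on_trans by meson
  then show ?thesis
    unfolding connected_conv induce_subgraph_verts by blast
qed

lemma flood_region_absorb:
  assumes "wf_digraph G" and "x \<in> flood_region G v \<omega>" and "(u, x) \<in> arcs_ends G" and "\<omega> u = \<omega> v"
  shows "u \<in> flood_region G v \<omega>"
proof -
  from assms(2) obtain S where S: "mono_connected G \<omega> S" "v \<in> S" "x \<in> S"
    by (auto simp: flood_region_def)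
  have "u \<in> verts G"
    using wf_digraph.adj_in_verts(1)[OF assms(1,3)] .
  moreover have "\<forall>y\<in>insert u S. \<omega> y = \<omega> v"
    using S assms(4) by (auto simp: mono_connected_def)
  ultimately have "mono_connected G \<omega> (insert u S)"
    using S connected_induce_insert[of G S x u] assms(3)
    unfolding mono_connected_def by blast
  with S(2) show ?thesis
    by (auto simp: flood_region_def)
qed

text \<open>A witness set lies inside the region, is therefore recoloured as a whole, and remains a
  witness.\<close>

lemma flood_region_mono:
  assumes "finite (verts G)"
  shows "flood_region G v \<omega> \<subseteq> flood_region G v (flood_move G v d \<omega>)"
proof
  fix x assume "x \<in> flood_region G v \<omega>"
  then obtain S where S: "mono_connected G \<omega> S" "v \<in> S" "x \<in> S"
    by (auto simp: flood_region_def)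
  then have "S \<subseteq> flood_region G v \<omega>"
    by (auto simp: flood_region_def)
  then have "mono_connected G (flood_move G v d \<omega>) S"
    using S(1) by (auto simp: mono_connected_def flood_move_eq[OF assms])
  with S show "x \<in> flood_region G v (flood_move G v d \<omega>)"
    by (auto simp: flood_region_def)
qed

section \<open>Sequences of moves and rounds\<close>

lemma flood_moves_Cons [simp]:
  "flood_moves G v (d # ds) \<omega> = flood_moves G v ds (flood_move G v d \<omega>)"
  by (simp add: flood_moves_def)

lemma flood_moves_Nil [simp]: "flood_moves G v [] \<omega> = \<omega>"
  by (simp add: flood_moves_def)

lemma flood_moves_append:
  "flood_moves G v (ds @ es) \<omega> = flood_moves G v es (flood_moves G v ds \<omega>)"
  by (simp add: flood_moves_def)

lemma flood_moves_in_colours: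
  assumes "finite (verts G)" and "ds \<in> lists C" and "\<omega> x \<in> C"
  shows "flood_moves G v ds \<omega> x \<in> C"
  using assms(2,3)
  by (induction ds arbitrary: \<omega>) (auto simp: flood_move_eq[OF assms(1)])

lemma flood_moves_absorb:
  assumes "fin_digraph G" and "v \<in> verts G"
    and "x \<in> flood_region G v \<omega>" and "(u, x) \<in> arcs_ends G"
    and "\<omega> u \<in> insert (\<omega> v) (set ds)"
  shows "u \<in> flood_region G v (flood_moves G v ds \<omega>)"
  using assms(3,5)
proof (induction ds arbitrary: \<omega>)
  case Nil
  then have "\<omega> u = \<omega> v" by simp
  from flood_region_absorb[OF fin_digraph.axioms(1)[OF assms(1)] Nil.prems(1) assms(4) this]
  show ?case by simp
next
  case (Cons d ds)
  let ?\<omega> = "flood_move G v d \<omega>"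
  interpret fin_digraph G by (rule assms(1))
  note move = flood_move_eq[OF finite_verts]
  have x: "x \<in> flood_region G v ?\<omega>"
    using Cons.prems(1) by (rule subsetD[OF flood_region_mono[OF finite_verts]])
  have v: "?\<omega> v = d"
    by (simp add: move pivot_in_flood_region[OF assms(2)])
  \<comment> \<open>The premise survives the move: if \<open>u\<close> was in the region, it now has
    the new pivot colour \<open>d\<close>; otherwise its colour is unchanged and differs from the
    old pivot colour, so it is \<open>d\<close> or still to be played.\<close>
  have "?\<omega> u \<in> insert (?\<omega> v) (set ds)"
  proof (cases "u \<in> flood_region G v \<omega>")
    case True
    then show ?thesis unfolding v by (simp add: move)
  next
    case False
    then have "\<omega> u \<noteq> \<omega> v"
      using flood_region_absorb[OF wf_digraph_axioms Cons.prems(1) assms(4)] by blast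
    with False Cons.prems(2) show ?thesis
      unfolding v by (auto simp: move)
  qed
  from Cons.IH[OF x this] show ?case
    by simp
qed

text \<open>Induction over rounds, with one move sequence serving all \<open>u\<close> at once.
  Balls are expressed by bounded walks to \<open>v\<close>, which avoids computing with
  distances.\<close>

lemma flood_moves_rounds:
  fixes C :: "'c set"
  assumes "fin_digraph G" and "v \<in> verts G" and "finite C" and "\<omega> ` verts G \<subseteq> C"
  shows "\<exists>ds\<in>lists C. length ds = (card C - 1) * k \<and>
    (\<forall>u p. pre_digraph.awalk G u p v \<longrightarrow> length p \<le> k \<longrightarrow>
       u \<in> flood_region G v (flood_moves G v ds \<omega>))"
proof (induction k)
  interpret fin_digraph G by (rule assms(1))
  case 0
  show ?case
    by (auto simp: awalk_Nil_iff pivot_in_flood_region[OF assms(2)])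
next
  interpret fin_digraph G by (rule assms(1))
  case (Suc k)
  then obtain ds where ds: "ds \<in> lists C" "length ds = (card C - 1) * k"
    and ball: "\<And>u p. awalk u p v \<Longrightarrow> length p \<le> k \<Longrightarrow>
      u \<in> flood_region G v (flood_moves G v ds \<omega>)"
    by auto
  define \<omega>' where "\<omega>' = flood_moves G v ds \<omega>"
  have colours: "\<omega>' u \<in> C" if "u \<in> verts G" for u
    unfolding \<omega>'_def using assms(4) that
    by (intro flood_moves_in_colours[OF finite_verts ds(1)]) auto
  \<comment> \<open>The omitted colour is the one the pivot has at the start of this round; leaving
    it out saves one move per round.\<close>
  obtain es where es: "set es = C - {\<omega>' v}" "distinct es"
    using finite_distinct_list[of "C - {\<omega>' v}"] assms(3) by auto
  then have len: "length es = card C - 1"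
    using distinct_card[of es] colours[OF assms(2)] assms(3) by simp
  have absorbed: "u \<in> flood_region G v (flood_moves G v es \<omega>')"
    if "awalk u p v" "length p \<le> Suc k" for u p
  proof (cases p)
    case Nil
    then have "u = v" using that by (simp add: awalk_Nil_iff)
    then show ?thesis by (simp add: pivot_in_flood_region[OF assms(2)])
  next
    case (Cons e q)
    \<comment> \<open>The first arc of the walk leads to a vertex within \<open>k\<close> steps of
      the pivot, which the induction hypothesis already places in the region.\<close>
    with that have e: "e \<in> arcs G" "u = tail G e" and q: "awalk (head G e) q v" "length q \<le> k"
      by (auto simp: awalk_Cons_iff)
    have "(u, head G e) \<in> arcs_ends G"
      using e by (auto simp: arcs_ends_def arc_to_ends_def)
    moreover have "\<omega>' u \<in> insert (\<omega>' v) (set es)"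
      using colours[of u] e es(1) by auto
    ultimately show ?thesis
      by (rule flood_moves_absorb[OF assms(1,2) ball[OF q, folded \<omega>'_def]])
  qed
  show ?case
  proof (intro bexI[of _ "ds @ es"] conjI allI impI)
    show "ds @ es \<in> lists C" "length (ds @ es) = (card C - 1) * Suc k"
      using ds es(1) len by auto
    show "u \<in> flood_region G v (flood_moves G v (ds @ es) \<omega>)"
      if "awalk u p v" "length p \<le> Suc k" for u p
      using absorbed[OF that] by (simp add: flood_moves_append \<omega>'_def)
  qed
qed

section \<open>From rounds to the bound on the optimum\<close>

lemma awalk_le_eccentricity:
  assumes "finite (verts G)" and "eccentricity G v = enat r" and "u \<in> verts G"
  obtains p where "pre_digraph.awalk G u p v" and "length p \<le> r"
proof -
  have "graph_dist G u v \<le> enat r"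
    using assms Max_ge[of "(\<lambda>u. graph_dist G u v) ` verts G" "graph_dist G u v"]
    by (simp add: eccentricity_def)
  \<comment> \<open>A strict bound on an infimum yields an actual walk via
    \<open>INF_less_iff\<close>, and its length is below \<open>Suc r\<close>.\<close>
  also have "\<dots> < enat (Suc r)"
    by simp
  finally show thesis
    using that by (auto simp: graph_dist_def INF_less_iff)
qed

lemma min_moves_le:
  assumes "fin_digraph G" and "v \<in> verts G" and "eccentricity G v = enat r"
    and "finite C" and "\<omega> ` verts G \<subseteq> C"
  shows "min_moves G C v \<omega> \<le> enat ((card C - 1) * r)"
proof -
  interpret fin_digraph G by (rule assms(1))
  obtain ds where ds: "ds \<in> lists C" "length ds = (card C - 1) * r"
    and ball: "\<And>u p. awalk u p v \<Longrightarrow> length p \<le> r \<Longrightarrow>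
      u \<in> flood_region G v (flood_moves G v ds \<omega>)"
    using flood_moves_rounds[OF assms(1,2,4,5), of r] by auto
  \<comment> \<open>No target colour is fixed in advance: the pivot's final colour serves, since
    \<open>min_moves\<close> minimises over all of \<open>C\<close>.\<close>
  let ?d = "flood_moves G v ds \<omega> v"
  have d: "?d \<in> C"
    using assms(2,5) by (intro flood_moves_in_colours[OF finite_verts ds(1)]) auto
  have "flood_moves G v ds \<omega> x = ?d" if x: "x \<in> verts G" for x
  proof -
    obtain p where "awalk x p v" "length p \<le> r"
      by (rule awalk_le_eccentricity[OF finite_verts assms(3) x])
    from colour_flood_region[OF ball[OF this]] show ?thesis .
  qed
  then have "min_moves_to G C v \<omega> ?d \<le> enat (length ds)"
    unfolding min_moves_to_def using ds(1) by (intro INF_lower) auto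
  moreover have "min_moves G C v \<omega> \<le> min_moves_to G C v \<omega> ?d"
    unfolding min_moves_def using d assms(4) by (intro Min_le) auto
  ultimately show ?thesis
    using ds(2) by simp
qed

lemma finite_surj_colourings:
  assumes "finite (verts G)"
  shows "finite (surj_colourings G c)"
  unfolding surj_colourings_def using finite_PiE[OF assms, of "\<lambda>_. {1..c}"] by simp

text \<open>An injection of the colours into the vertices has a surjective left inverse.
  Nonemptiness is what allows \<open>Max\<close> to be bounded elementwise.\<close>

lemma surj_colourings_nonempty:
  assumes "finite (verts G)" and "1 \<le> c" and "c \<le> card (verts G)"
  shows "surj_colourings G c \<noteq> {}"
proof -
  have "{1..c} \<noteq> {}" "card {1..c} \<le> card (verts G)"
    using assms by auto
  then obtain f where "inj_on f {1..c}" "f ` {1..c} \<subseteq> verts G"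
    using card_le_inj[OF _ assms(1), of "{1..c}"] by auto
  then obtain g where "g ` verts G = {1..c}"
    using inj_on_iff_surj[OF \<open>{1..c} \<noteq> {}\<close>, of "verts G"] by auto
  then have "restrict g (verts G) \<in> surj_colourings G c"
    by (auto simp: surj_colourings_def)
  then show ?thesis by auto
qed

theorem proposition2p11:
  fixes G :: "('a, 'b) pre_digraph" and v :: 'a and r c :: nat
  assumes "graph G"
    and "Digraph_Component.connected G"
    and "v \<in> verts G"
    and "eccentricity G v = enat r"
    and "1 \<le> c" and "c \<le> card (verts G)"
  shows "max_min_moves G c v \<le> enat ((c - 1) * r)"
proof -
  interpret graph G by (rule assms(1))
  have "min_moves G {1..c} v \<omega> \<le> enat ((c - 1) * r)" if "\<omega> \<in> surj_colourings G c" for \<omega>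
    using min_moves_le[OF fin_digraph_axioms assms(3,4), of "{1..c}" \<omega>] that
    by (simp add: surj_colourings_def)
  then show ?thesis
    unfolding max_min_moves_def
    using finite_surj_colourings[OF finite_verts, of c]
      surj_colourings_nonempty[OF finite_verts assms(5,6)]
    by simp
qed

end
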